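(* Let $p>0$, $q\in\mathbb{R}$, and let $f:L^2(0,1)\to L^2(0,1)$ be a continuous mapping. Let $\gamma>0$ and suppose that the kernel $k\in C^0([0,1])$ achieves Input-to-State Stabilization with gain $\frac{\gamma}{p\pi^2}$ of the linear system $$u_t(t,x)=p\,u_{xx}(t,x)-q\,u(t,x)+v(t,x)\ (t>0,\ x\in(0,1)),\qquad u(t,0)=0,\quad u(t,1)=U(t)\ (t>0).$$ Suppose that there exists a constant $M\ge 0$ such that $$\|f(u)\|\le M\|u\|\quad\text{for all }u\in L^2(0,1),$$ and that $$M<\gamma^{-1}p\pi^2 .$$ Then the kernel $k$ achieves robust global exponential stabilization of the system with disturbance, i.e., there exist constants $R,\omega>0$ such that for every disturbance $d:\mathbb{R}_+\to[-1,1]$, every solution $u\in C^0(\mathbb{R}_+;L^2(0,1))\cap C^1((0,+\infty)\times[0,1])$ with $u[t]\in C^2([0,1])$ for $t>0$ of the closed-loop system $$u_t(t,x)=p\,u_{xx}(t,x)-q\,u(t,x)+d(t)\,(f(u[t]))(x)\quad(t>0,\ x\in(0,1)),$$ $$u(t,0)=0,\qquad u(t,1)=\int_0^1 k(x)u(t,x)\,dx\quad(t>0)$$ satisfies $$\|u[t]\|\le R\exp(-\omega t)\|u[0]\|\quad\text{for all }t\ge 0.$$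
   Context: Notation: $\mathbb{R}_+=[0,+\infty)$; $\|\cdot\|$ is the norm of $L^2(0,1)$, $\|g\|=\left(\int_0^1|g(x)|^2dx\right)^{1/2}$; for $u:\mathbb{R}_+\times[0,1]\to\mathbb{R}$, $u[t]$ denotes the profile $(u[t])(x)=u(t,x)$; $C^0(\mathbb{R}_+;L^2(0,1))$ is the class of functions for which $t\mapsto u[t]\in L^2(0,1)$ is continuous. Definition (Input-to-State Stabilization). Consider $u_t=p u_{xx}-q u+v$ for $t>0$, $x\in(0,1)$, with $u(t,0)=0$, $u(t,1)=U(t)$ for $t>0$, where $v:\mathbb{R}_+\times[0,1]\to\mathbb{R}$ is a distributed input (with $v[t]\in L^2(0,1)$) and $U$ is the control input. A kernel $k\in C^0([0,1])$ achieves Input-to-State Stabilization with gain $g\ge 0$ of this system if there exist constants $G,\sigma>0$ such that (for every distributed input $v$) every solution $u\in C^0(\mathbb{R}_+;L^2(0,1))\cap C^1((0,+\infty)\times[0,1])$ with $u[t]\in C^2([0,1])$ for $t>0$ of the closed-loop system with $U(t)=\int_0^1k(x)u(t,x)\,dx$ for $t>0$ satisfies $$\|u[t]\|\le G\exp(-\sigma t)\|u[0]\|+g\sup_{0\le s\le t}\|v[s]\|\quad\text{for all }t\ge 0.$$ *)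

theory Defs
  imports "HOL-Analysis.Analysis"
begin

abbreviation unit_leb :: "real measure" where
  "unit_leb \<equiv> lebesgue_on {0<..<1}"

(* Elements of L2(0,1) are handled through representatives: functions real => real, of which
   only the values on (0,1), up to null sets, matter. *)
definition L2 :: "(real \<Rightarrow> real) set" where
  "L2 = {h. h \<in> borel_measurable unit_leb \<and> integrable unit_leb (\<lambda>x. \<bar>h x\<bar>\<^sup>2)}"

definition L2norm :: "(real \<Rightarrow> real) \<Rightarrow> real" where
  "L2norm h = sqrt (\<integral>x. \<bar>h x\<bar>\<^sup>2 \<partial>unit_leb)"

definition L2_continuous_map :: "((real \<Rightarrow> real) \<Rightarrow> (real \<Rightarrow> real)) \<Rightarrow> bool" where
  "L2_continuous_map f \<longleftrightarrow>
     (\<forall>h\<in>L2. f h \<in> L2) \<and>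
     (\<forall>h\<in>L2. \<forall>\<epsilon>>0. \<exists>\<delta>>0. \<forall>w\<in>L2.
        L2norm (\<lambda>x. w x - h x) < \<delta> \<longrightarrow> L2norm (\<lambda>x. f w x - f h x) < \<epsilon>)"

(* A map on representatives that is continuous for the seminorm L2norm descends to a.e.-classes,
   so L2_continuous_map describes exactly the continuous self-maps of the quotient space. *)
lemma L2_continuous_map_AE_cong:
  assumes f: "L2_continuous_map f" and h: "h \<in> L2" and w: "w \<in> L2"
    and eq: "AE x in unit_leb. w x = h x"
  shows "AE x in unit_leb. f w x = f h x"
proof -
  have fm: "f h \<in> L2" "f w \<in> L2"
    using f h w by (auto simp: L2_continuous_map_def)
  have "(\<integral>x. \<bar>w x - h x\<bar>\<^sup>2 \<partial>unit_leb) = 0"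
    using eq by (intro integral_eq_zero_AE) auto
  then have z: "L2norm (\<lambda>x. w x - h x) = 0"
    by (simp add: L2norm_def)
  have "L2norm (\<lambda>x. f w x - f h x) < \<epsilon>" if "\<epsilon> > 0" for \<epsilon>
    using f h w z that unfolding L2_continuous_map_def by metis
  then have "L2norm (\<lambda>x. f w x - f h x) \<le> 0"
    by (meson less_irrefl not_le)
  then have 0: "(\<integral>x. \<bar>f w x - f h x\<bar>\<^sup>2 \<partial>unit_leb) = 0"
    unfolding L2norm_def
    by (metis (no_types, lifting) antisym integral_nonneg_AE AE_I2 real_sqrt_le_0_iff
        zero_le_power2)
  have int: "integrable unit_leb (\<lambda>x. \<bar>f w x - f h x\<bar>\<^sup>2)"
  proof (rule Bochner_Integration.integrable_bound)
    show "integrable unit_leb (\<lambda>x. 2 * \<bar>f w x\<bar>\<^sup>2 + 2 * \<bar>f h x\<bar>\<^sup>2)"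
      using fm by (auto simp: L2_def)
    show "(\<lambda>x. \<bar>f w x - f h x\<bar>\<^sup>2) \<in> borel_measurable unit_leb"
      using fm unfolding L2_def by (auto intro!: borel_measurable_power borel_measurable_diff)
    have "(a - b)\<^sup>2 \<le> 2 * a\<^sup>2 + 2 * b\<^sup>2" for a b :: real
      using zero_le_power2[of "a + b"] by (simp add: power2_eq_square algebra_simps)
    then show "AE x in unit_leb. norm (\<bar>f w x - f h x\<bar>\<^sup>2) \<le> norm (2 * \<bar>f w x\<bar>\<^sup>2 + 2 * \<bar>f h x\<bar>\<^sup>2)"
      by simp
  qed
  have "AE x in unit_leb. \<bar>f w x - f h x\<bar>\<^sup>2 = 0"
    using 0 integral_nonneg_eq_0_iff_AE[OF int] by simp
  then show ?thesis by simp
qed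

definition C0_time_L2 :: "(real \<Rightarrow> real \<Rightarrow> real) \<Rightarrow> bool" where
  "C0_time_L2 u \<longleftrightarrow>
     (\<forall>t\<ge>0. u t \<in> L2 \<and> ((\<lambda>s. L2norm (\<lambda>x. u s x - u t x)) \<longlongrightarrow> 0) (at t within {0..}))"

(* Derivatives in x are one-sided at the end points of [0,1]. *)
definition C1_slab :: "(real \<Rightarrow> real \<Rightarrow> real) \<Rightarrow> bool" where
  "C1_slab u \<longleftrightarrow>
     (\<exists>ut ux. continuous_on ({0<..} \<times> {0..1}) (\<lambda>(t, x). ut t x) \<and>
              continuous_on ({0<..} \<times> {0..1}) (\<lambda>(t, x). ux t x) \<and>
              (\<forall>t>0. \<forall>x\<in>{0..1}.
                 ((\<lambda>s. u s x) has_real_derivative ut t x) (at t) \<and>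
                 (u t has_real_derivative ux t x) (at x within {0..1})))"

definition C2_unit :: "(real \<Rightarrow> real) \<Rightarrow> bool" where
  "C2_unit h \<longleftrightarrow>
     (\<exists>h' h''. continuous_on {0..1} h'' \<and>
               (\<forall>x\<in>{0..1}. (h has_real_derivative h' x) (at x within {0..1}) \<and>
                            (h' has_real_derivative h'' x) (at x within {0..1})))"

definition solution_regularity :: "(real \<Rightarrow> real \<Rightarrow> real) \<Rightarrow> bool" where
  "solution_regularity u \<longleftrightarrow> C0_time_L2 u \<and> C1_slab u \<and> (\<forall>t>0. C2_unit (u t))"

definition closed_loop_boundary :: "(real \<Rightarrow> real) \<Rightarrow> (real \<Rightarrow> real \<Rightarrow> real) \<Rightarrow> bool" where
  "closed_loop_boundary k u \<longleftrightarrow>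
     (\<forall>t>0. u t 0 = 0 \<and> u t 1 = integral {0..1} (\<lambda>x. k x * u t x))"

definition linear_solution ::
    "real \<Rightarrow> real \<Rightarrow> (real \<Rightarrow> real) \<Rightarrow> (real \<Rightarrow> real \<Rightarrow> real) \<Rightarrow> (real \<Rightarrow> real \<Rightarrow> real) \<Rightarrow> bool" where
  "linear_solution p q k v u \<longleftrightarrow>
     solution_regularity u \<and> closed_loop_boundary k u \<and>
     (\<forall>t>0. \<forall>x\<in>{0<..<1}.
        deriv (\<lambda>s. u s x) t = p * deriv (deriv (u t)) x - q * u t x + v t x)"

(* The supremum is taken in [0,\<infinity>], so that the estimate is void when g > 0 and the input is
   unbounded in norm on [0,t]. *)
definition achieves_ISS :: "real \<Rightarrow> real \<Rightarrow> (real \<Rightarrow> real) \<Rightarrow> real \<Rightarrow> bool" where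
  "achieves_ISS p q k g \<longleftrightarrow>
     continuous_on {0..1} k \<and> g \<ge> 0 \<and>
     (\<exists>G>0. \<exists>\<sigma>>0. \<forall>v u.
        (\<forall>t\<ge>0. v t \<in> L2) \<longrightarrow> linear_solution p q k v u \<longrightarrow>
        (\<forall>t\<ge>0. ennreal (L2norm (u t)) \<le>
           ennreal (G * exp (- \<sigma> * t) * L2norm (u 0))
           + ennreal g * (SUP s\<in>{0..t}. ennreal (L2norm (v s)))))"

(* As f (u t) is an element of L2(0,1), i.e. a class modulo null sets, the equation is required
   for almost every x; since the other terms are continuous in x, this says that the continuous
   representative of d t * f (u t) satisfies it at every x. *)
definition disturbed_solution ::
    "real \<Rightarrow> real \<Rightarrow> (real \<Rightarrow> real) \<Rightarrow> ((real \<Rightarrow> real) \<Rightarrow> (real \<Rightarrow> real)) \<Rightarrow> (real \<Rightarrow> real)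
     \<Rightarrow> (real \<Rightarrow> real \<Rightarrow> real) \<Rightarrow> bool" where
  "disturbed_solution p q k f d u \<longleftrightarrow>
     solution_regularity u \<and> closed_loop_boundary k u \<and>
     (\<forall>t>0. AE x in unit_leb.
        deriv (\<lambda>s. u s x) t = p * deriv (deriv (u t)) x - q * u t x + d t * f (u t) x)"

definition achieves_robust_GES ::
    "real \<Rightarrow> real \<Rightarrow> (real \<Rightarrow> real) \<Rightarrow> ((real \<Rightarrow> real) \<Rightarrow> (real \<Rightarrow> real)) \<Rightarrow> bool" where
  "achieves_robust_GES p q k f \<longleftrightarrow>
     (\<exists>R>0. \<exists>\<omega>>0. \<forall>d u.
        (\<forall>t\<ge>0. d t \<in> {-1..1}) \<longrightarrow> disturbed_solution p q k f d u \<longrightarrow>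
        (\<forall>t\<ge>0. L2norm (u t) \<le> R * exp (- \<omega> * t) * L2norm (u 0)))"

end

theory Submission
  imports Defs
begin

text \<open>
  The argument is a small-gain argument in time-domain form. Along a solution of the disturbed
  loop, the term \<open>d(t) f(u[t])\<close> is a distributed input for the linear loop, of norm at most
  \<open>M \<parallel>u[t]\<parallel>\<close>. As the plant and the feedback do not depend on time, the input-to-state estimate
  can be started at any time \<open>\<tau> \<ge> 0\<close>, so that \<open>N(t) = \<parallel>u[t]\<parallel>\<close> satisfies
    \<open>N(\<tau> + t) \<le> G exp(-\<sigma>t) N(\<tau>) + \<kappa> sup {N(s) | \<tau> \<le> s \<le> \<tau> + t}\<close>
  with loop gain \<open>\<kappa> = (\<gamma> / (p \<pi>\<^sup>2)) M < 1\<close>.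

  Such an inequality forces uniform exponential decay (\<open>small_gain_exponential_decay\<close>). Taking the
  supremum over a bounded window and absorbing the last term gives \<open>N(t) \<le> G/(1-\<kappa>) N(\<tau>)\<close> for all
  \<open>t \<ge> \<tau>\<close>; this needs \<open>N\<close> to be locally bounded, which follows from the continuity of
  \<open>t \<mapsto> u[t]\<close> (\<open>C0_time_L2_bounded\<close>). If \<open>T\<close> is so long that
  \<open>G exp(-\<sigma>T) \<le> (1-\<kappa>)/2\<close>, then waiting for a time \<open>T\<close> multiplies the supremum of \<open>N\<close> over the
  remaining half-line by at most \<open>(1+\<kappa>)/2 < 1\<close>.

  One point needs care. The disturbed equation holds at almost every \<open>x\<close>, whereas the linear
  equation with input \<open>v\<close> is required at every \<open>x\<close>. The input is therefore taken to be the residual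
  \<open>u\<^sub>t - p u\<^sub>x\<^sub>x + q u\<close> itself, which is almost everywhere equal to \<open>d(t) f(u[t])\<close>, hence is in
  \<open>L\<^sup>2(0,1)\<close> with the same norm.
\<close>

section \<open>A scalar small-gain lemma\<close>

text \<open>
  The supremum over \<open>{\<tau>..\<tau>+t}\<close> is represented by its upper bounds \<open>B\<close>, so that no
  junk value of \<open>Sup\<close> can occur. Local boundedness is included because the inequality alone
  would be void on a window where \<open>N\<close> has no upper bound.
\<close>

definition small_gain :: "real \<Rightarrow> real \<Rightarrow> real \<Rightarrow> (real \<Rightarrow> real) \<Rightarrow> bool" where
  "small_gain G \<sigma> \<kappa> N \<longleftrightarrow>
     (\<forall>t\<ge>0. 0 \<le> N t) \<and>
     (\<forall>b\<ge>0. \<exists>B. \<forall>s\<in>{0..b}. N s \<le> B) \<and>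
     (\<forall>\<tau>\<ge>0. \<forall>t\<ge>0. \<forall>B. (\<forall>s\<in>{\<tau>..\<tau> + t}. N s \<le> B) \<longrightarrow>
        N (\<tau> + t) \<le> G * exp (- \<sigma> * t) * N \<tau> + \<kappa> * B)"

lemma small_gainD:
  assumes "small_gain G \<sigma> \<kappa> N"
  shows "t \<ge> 0 \<Longrightarrow> 0 \<le> N t"
    and "b \<ge> 0 \<Longrightarrow> \<exists>B. \<forall>s\<in>{0..b}. N s \<le> B"
    and "\<lbrakk>\<tau> \<ge> 0; t \<ge> 0; \<And>s. \<lbrakk>\<tau> \<le> s; s \<le> \<tau> + t\<rbrakk> \<Longrightarrow> N s \<le> B\<rbrakk>
           \<Longrightarrow> N (\<tau> + t) \<le> G * exp (- \<sigma> * t) * N \<tau> + \<kappa> * B"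
  using assms unfolding small_gain_def by simp_all

text \<open>
  The least upper bound of \<open>N\<close> over a bounded window reproduces
  itself with factor \<open>\<kappa> < 1\<close> and can be absorbed. Finiteness of that bound is essential.
\<close>

lemma small_gain_uniform_bound:
  assumes "G \<ge> 0" "\<sigma> \<ge> 0" "\<kappa> < 1" "\<tau> \<ge> 0" "\<tau> \<le> s"
    and N: "small_gain G \<sigma> \<kappa> N"
  shows "N s \<le> G / (1 - \<kappa>) * N \<tau>"
proof -
  note N0 = small_gainD(1)[OF N] and bdd = small_gainD(2)[OF N] and gain = small_gainD(3)[OF N]
  define C where "C = Sup (N ` {\<tau>..s})"
  obtain B where "\<forall>r\<in>{0..s}. N r \<le> B"
    using bdd[of s] assms(4,5) by auto
  then have bd: "bdd_above (N ` {\<tau>..s})"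
    using \<open>\<tau> \<ge> 0\<close> by (intro bdd_aboveI2[where M = B]) auto
  have C_upper: "N r \<le> C" if "\<tau> \<le> r" "r \<le> s" for r
    unfolding C_def using that by (intro cSUP_upper bd) auto
  have step: "N r \<le> G * N \<tau> + \<kappa> * C" if r: "r \<in> {\<tau>..s}" for r
  proof -
    have "N (\<tau> + (r - \<tau>)) \<le> G * exp (- \<sigma> * (r - \<tau>)) * N \<tau> + \<kappa> * C"
      using r \<open>\<tau> \<ge> 0\<close> by (intro gain C_upper) auto
    moreover have "exp (- \<sigma> * (r - \<tau>)) \<le> 1"
      using r \<open>\<sigma> \<ge> 0\<close> by (simp add: mult_nonpos_nonneg)
    then have "G * exp (- \<sigma> * (r - \<tau>)) * N \<tau> \<le> G * 1 * N \<tau>"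
      using \<open>G \<ge> 0\<close> N0[OF \<open>\<tau> \<ge> 0\<close>] by (intro mult_right_mono mult_left_mono)
    ultimately show ?thesis
      by simp
  qed
  have "C \<le> G * N \<tau> + \<kappa> * C"
    unfolding C_def by (rule cSUP_least) (use step assms(5) in \<open>auto simp: C_def\<close>)
  then have "C \<le> G / (1 - \<kappa>) * N \<tau>"
    using \<open>\<kappa> < 1\<close> by (simp add: field_simps)
  with C_upper[of s] assms(5) show ?thesis
    by simp
qed

text \<open>
  The constants depend on \<open>G\<close>, \<open>\<sigma>\<close> and \<open>\<kappa>\<close> alone, not on \<open>N\<close>: this is what makes the
  stabilization robust, i.e. uniform in the disturbance.
\<close>

lemma small_gain_exponential_decay:
  fixes G \<sigma> \<kappa> :: real
  assumes G: "G > 0" and \<sigma>: "\<sigma> > 0" and \<kappa>: "0 \<le> \<kappa>" "\<kappa> < 1"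
  obtains R \<omega> where "R > 0" "\<omega> > 0"
    "\<And>N t. \<lbrakk>small_gain G \<sigma> \<kappa> N; t \<ge> 0\<rbrakk> \<Longrightarrow> N t \<le> R * exp (- \<omega> * t) * N 0"
proof -
  define K where "K = G / (1 - \<kappa>)"
  define \<theta> where "\<theta> = (1 + \<kappa>) / 2"
  have K: "K > 0" and \<theta>: "0 < \<theta>" "\<theta> < 1"
    using G \<kappa> by (auto simp: K_def \<theta>_def)
  \<comment> \<open>From time \<open>T\<close> on, the transient factor \<open>G exp(-\<sigma>r)\<close> is within half of the margin \<open>1 - \<kappa>\<close>.\<close>
  define T where "T = max 1 (ln (2 * G / (1 - \<kappa>)) / \<sigma>)"
  have T: "T > 0"
    by (simp add: T_def)
  have decay: "G * exp (- \<sigma> * r) \<le> (1 - \<kappa>) / 2" if "r \<ge> T" for r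
  proof -
    have "ln (2 * G / (1 - \<kappa>)) \<le> \<sigma> * r"
      using that \<sigma> by (simp add: T_def field_simps)
    then have "exp (ln (2 * G / (1 - \<kappa>))) \<le> exp (\<sigma> * r)"
      by simp
    moreover have "2 * G / (1 - \<kappa>) > 0"
      using G \<kappa> by simp
    ultimately have "2 * G / (1 - \<kappa>) \<le> exp (\<sigma> * r)"
      by simp
    then show ?thesis
      using \<kappa> by (simp add: exp_minus field_simps)
  qed
  define \<omega> where "\<omega> = ln (1 / \<theta>) / T"
  have \<omega>: "\<omega> > 0"
    using \<theta> T by (simp add: \<omega>_def)
  show thesis
  proof (rule that[of "K / \<theta>" \<omega>])
    show "K / \<theta> > 0"
      using K \<theta> by simp
    show "\<omega> > 0"
      by (fact \<omega>)
  next
    fix N :: "real \<Rightarrow> real" and t :: real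
    assume N: "small_gain G \<sigma> \<kappa> N" and t: "t \<ge> 0"
    note N0 = small_gainD(1)[OF N] and gain = small_gainD(3)[OF N]
    have geometric: "N s \<le> \<theta> ^ n * (K * N 0)" if "s \<ge> real n * T" for s n
      using that
    proof (induction n arbitrary: s)
      case 0
      then show ?case
        using small_gain_uniform_bound[OF _ _ \<kappa>(2) _ _ N, of 0 s] G \<sigma>
        by (simp add: K_def)
    next
      case (Suc n)
      define b where "b = \<theta> ^ n * (K * N 0)"
      define \<tau> where "\<tau> = real n * T"
      have \<tau>: "\<tau> \<ge> 0" "s - \<tau> \<ge> T"
        using T Suc.prems by (auto simp: \<tau>_def algebra_simps)
      have le_b: "N r \<le> b" if "r \<ge> \<tau>" for r
        using Suc.IH that by (simp add: b_def \<tau>_def)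
      have b: "0 \<le> b"
        using le_b[of \<tau>] N0[of \<tau>] \<tau> by simp
      have "N (\<tau> + (s - \<tau>)) \<le> G * exp (- \<sigma> * (s - \<tau>)) * N \<tau> + \<kappa> * b"
        using \<tau> T by (intro gain le_b) auto
      also have "G * exp (- \<sigma> * (s - \<tau>)) * N \<tau> \<le> (1 - \<kappa>) / 2 * b"
        using decay[OF \<tau>(2)] le_b[of \<tau>] N0[of \<tau>] \<tau>(1) \<kappa> by (intro mult_mono) auto
      finally have "N s \<le> \<theta> * b"
        by (simp add: \<theta>_def algebra_simps add_divide_distrib diff_divide_distrib)
      then show ?case
        by (simp add: b_def)
    qed
    define n where "n = nat \<lfloor>t / T\<rfloor>"
    have n: "real n = of_int \<lfloor>t / T\<rfloor>"
      using t T by (simp add: n_def)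
    have "real n \<le> t / T" "t / T \<le> real n + 1"
      unfolding n by linarith+
    then have "real n * T \<le> t" "t / T - 1 \<le> real n"
      using T by (simp_all add: field_simps)
    \<comment> \<open>The factor \<open>1/\<theta>\<close> in \<open>R\<close> pays for rounding \<open>t / T\<close> down to an integer.\<close>
    have "\<theta> ^ n = \<theta> powr (real n)"
      using \<theta> by (simp add: powr_realpow)
    also have "\<dots> \<le> \<theta> powr (t / T - 1)"
      using \<open>t / T - 1 \<le> real n\<close> \<theta> by (intro powr_mono') auto
    also have "\<dots> = exp (- \<omega> * t) / \<theta>"
      using \<theta> T by (simp add: powr_def \<omega>_def ln_div left_diff_distrib exp_diff)
    finally have "\<theta> ^ n * (K * N 0) \<le> exp (- \<omega> * t) / \<theta> * (K * N 0)"
      using K N0[of 0] by (intro mult_right_mono) auto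
    with geometric[OF \<open>real n * T \<le> t\<close>] show "N t \<le> K / \<theta> * exp (- \<omega> * t) * N 0"
      by (simp add: mult_ac)
  qed
qed

section \<open>The norm of \<open>L\<^sup>2(0,1)\<close>\<close>

lemma L2norm_nonneg: "0 \<le> L2norm h"
  by (simp add: L2norm_def)

lemma L2norm_cmult: "L2norm (\<lambda>x. c * h x) = \<bar>c\<bar> * L2norm h"
  by (simp add: L2norm_def power_mult_distrib real_sqrt_mult)

lemma L2_cmult: "h \<in> L2 \<Longrightarrow> (\<lambda>x. c * h x) \<in> L2"
  by (auto simp: L2_def power_mult_distrib)

lemma L2_diff:
  assumes "g \<in> L2" "h \<in> L2"
  shows "(\<lambda>x. g x - h x) \<in> L2"
proof -
  have meas: "(\<lambda>x. g x - h x) \<in> borel_measurable unit_leb"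
    using assms by (auto simp: L2_def)
  have "integrable unit_leb (\<lambda>x. \<bar>g x - h x\<bar>\<^sup>2)"
  proof (rule Bochner_Integration.integrable_bound)
    show "integrable unit_leb (\<lambda>x. 2 * \<bar>g x\<bar>\<^sup>2 + 2 * \<bar>h x\<bar>\<^sup>2)"
      using assms by (auto simp: L2_def)
    show "(\<lambda>x. \<bar>g x - h x\<bar>\<^sup>2) \<in> borel_measurable unit_leb"
      using meas by auto
    have "(a - b)\<^sup>2 \<le> 2 * a\<^sup>2 + 2 * b\<^sup>2" for a b :: real
      using zero_le_power2[of "a + b"] by (simp add: power2_eq_square algebra_simps)
    then show "AE x in unit_leb. norm (\<bar>g x - h x\<bar>\<^sup>2) \<le> norm (2 * \<bar>g x\<bar>\<^sup>2 + 2 * \<bar>h x\<bar>\<^sup>2)"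
      by simp
  qed
  with meas show ?thesis
    by (simp add: L2_def)
qed

text \<open>
  A crude substitute for the triangle inequality, enough for local boundedness; it holds pointwise
  under the integral sign.
\<close>

lemma L2norm_square_le:
  assumes g: "g \<in> L2" and h: "h \<in> L2"
  shows "(L2norm g)\<^sup>2 \<le> 2 * (L2norm (\<lambda>x. g x - h x))\<^sup>2 + 2 * (L2norm h)\<^sup>2"
proof -
  have sq: "(L2norm w)\<^sup>2 = (\<integral>x. \<bar>w x\<bar>\<^sup>2 \<partial>unit_leb)" for w
    unfolding L2norm_def by (rule real_sqrt_pow2) (simp add: integral_nonneg_AE)
  have int: "integrable unit_leb (\<lambda>x. \<bar>g x\<bar>\<^sup>2)" "integrable unit_leb (\<lambda>x. \<bar>h x\<bar>\<^sup>2)"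
    "integrable unit_leb (\<lambda>x. \<bar>g x - h x\<bar>\<^sup>2)"
    using g h L2_diff[OF g h] by (auto simp: L2_def)
  have "a\<^sup>2 \<le> 2 * (a - b)\<^sup>2 + 2 * b\<^sup>2" for a b :: real
    using zero_le_power2[of "a - 2 * b"] by (simp add: power2_eq_square algebra_simps)
  then have "(\<integral>x. \<bar>g x\<bar>\<^sup>2 \<partial>unit_leb) \<le> (\<integral>x. 2 * \<bar>g x - h x\<bar>\<^sup>2 + 2 * \<bar>h x\<bar>\<^sup>2 \<partial>unit_leb)"
    using int by (intro integral_mono) auto
  also have "\<dots> = 2 * (\<integral>x. \<bar>g x - h x\<bar>\<^sup>2 \<partial>unit_leb) + 2 * (\<integral>x. \<bar>h x\<bar>\<^sup>2 \<partial>unit_leb)"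
    using int by simp
  finally show ?thesis
    by (simp only: sq)
qed

lemma borel_measurable_lebesgue_on_AE:
  fixes g h :: "real \<Rightarrow> real"
  assumes g: "g \<in> borel_measurable (lebesgue_on S)" and S: "S \<in> sets lebesgue"
    and eq: "AE x in lebesgue_on S. g x = h x"
  shows "h \<in> borel_measurable (lebesgue_on S)"
proof -
  have "(\<lambda>x. if x \<in> S then g x else 0) \<in> borel_measurable lebesgue"
    using g S by (simp add: borel_measurable_if)
  moreover have "AE x in lebesgue. (if x \<in> S then g x else 0) = (if x \<in> S then h x else 0)"
    using eq S by (auto simp: AE_restrict_space_iff)
  ultimately have "(\<lambda>x. if x \<in> S then h x else 0) \<in> borel_measurable lebesgue"
    by (rule borel_measurable_AE)
  then show ?thesis
    using S by (simp add: borel_measurable_if)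
qed

lemma L2_AE_cong:
  assumes g: "g \<in> L2" and eq: "AE x in unit_leb. h x = g x"
  shows "h \<in> L2" and "L2norm h = L2norm g"
proof -
  have gm: "g \<in> borel_measurable unit_leb" and gi: "integrable unit_leb (\<lambda>x. \<bar>g x\<bar>\<^sup>2)"
    using g by (auto simp: L2_def)
  have hm: "h \<in> borel_measurable unit_leb"
    by (rule borel_measurable_lebesgue_on_AE[OF gm]) (use eq in auto)
  have sq: "AE x in unit_leb. \<bar>g x\<bar>\<^sup>2 = \<bar>h x\<bar>\<^sup>2"
    using eq by eventually_elim simp
  have m: "(\<lambda>x. \<bar>g x\<bar>\<^sup>2) \<in> borel_measurable unit_leb" "(\<lambda>x. \<bar>h x\<bar>\<^sup>2) \<in> borel_measurable unit_leb"
    using gm hm by auto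
  show "h \<in> L2"
    using hm integrable_cong_AE_imp[OF gi m(2) sq] by (simp add: L2_def)
  show "L2norm h = L2norm g"
    unfolding L2norm_def using integral_cong_AE[OF m sq] by simp
qed

lemma C0_time_L2_bounded:
  assumes u: "C0_time_L2 u" and b: "b \<ge> 0"
  shows "\<exists>B. \<forall>s\<in>{0..b}. L2norm (u s) \<le> B"
proof -
  \<comment> \<open>The intervals of a bisection may stick out to the left of \<open>0\<close>, where nothing is known.\<close>
  define P where "P a b = (\<exists>B. \<forall>s\<in>{a..b}. 0 \<le> s \<longrightarrow> L2norm (u s) \<le> B)" for a b
  have "P 0 b"
    using b
  proof (induction rule: Bolzano)
    case (trans a b c)
    from \<open>P a b\<close> \<open>P b c\<close> obtain B B' where B: "\<forall>s\<in>{a..b}. 0 \<le> s \<longrightarrow> L2norm (u s) \<le> B"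
      "\<forall>s\<in>{b..c}. 0 \<le> s \<longrightarrow> L2norm (u s) \<le> B'"
      unfolding P_def by blast
    have "L2norm (u s) \<le> max B B'" if "s \<in> {a..c}" "0 \<le> s" for s
      using B that by (cases "s \<le> b") (auto simp: le_max_iff_disj)
    then show ?case
      unfolding P_def by (intro exI[of _ "max B B'"] ballI impI)
  next
    case (local t)
    have "((\<lambda>s. L2norm (\<lambda>x. u s x - u t x)) \<longlongrightarrow> 0) (at t within {0..})"
      using u local by (auto simp: C0_time_L2_def)
    then have "eventually (\<lambda>s. L2norm (\<lambda>x. u s x - u t x) < 1) (at t within {0..})"
      by (rule order_tendstoD) simp
    then obtain d where d: "d > 0"
      "\<And>s. \<lbrakk>s \<ge> 0; s \<noteq> t; dist s t < d\<rbrakk> \<Longrightarrow> L2norm (\<lambda>x. u s x - u t x) < 1"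
      by (auto simp: eventually_at)
    define B where "B = sqrt (2 + 2 * (L2norm (u t))\<^sup>2)"
    have near: "L2norm (u s) \<le> B" if "s \<ge> 0" "dist s t < d" for s
    proof -
      have "L2norm (\<lambda>x. u s x - u t x) \<le> 1"
        using d(2)[of s] that by (cases "s = t") (auto simp: L2norm_def)
      then have "(L2norm (\<lambda>x. u s x - u t x))\<^sup>2 \<le> 1"
        using L2norm_nonneg by (simp add: power_le_one)
      moreover have "u s \<in> L2" "u t \<in> L2"
        using u that local by (auto simp: C0_time_L2_def)
      ultimately have "(L2norm (u s))\<^sup>2 \<le> 2 + 2 * (L2norm (u t))\<^sup>2"
        using L2norm_square_le[of "u s" "u t"] by linarith
      then show ?thesis
        unfolding B_def by (rule real_le_rsqrt)
    qed
    have "\<forall>a b. a \<le> t \<and> t \<le> b \<and> b - a < d \<longrightarrow> P a b"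
      unfolding P_def using near by (intro allI impI exI[of _ B]) (auto simp: dist_real_def)
    with \<open>d > 0\<close> show ?case
      by blast
  qed
  then show ?thesis
    by (auto simp: P_def)
qed

section \<open>Restarting a solution at a later time\<close>

lemma C0_time_L2_shift:
  assumes u: "C0_time_L2 u" and \<tau>: "\<tau> \<ge> 0"
  shows "C0_time_L2 (\<lambda>t. u (t + \<tau>))"
  unfolding C0_time_L2_def
proof (intro allI impI conjI)
  fix t :: real assume t: "t \<ge> 0"
  show "u (t + \<tau>) \<in> L2"
    using u t \<tau> by (auto simp: C0_time_L2_def)
  have "((\<lambda>s. L2norm (\<lambda>x. u s x - u (t + \<tau>) x)) \<longlongrightarrow> 0) (at (t + \<tau>) within {0..})"
    using u t \<tau> by (auto simp: C0_time_L2_def)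
  moreover have "filterlim (\<lambda>s. s + \<tau>) (at (t + \<tau>) within {0..}) (at t within {0..})"
    using \<tau> by (auto simp: filterlim_at eventually_at intro!: tendsto_intros exI[of _ 1])
  ultimately show "((\<lambda>s. L2norm (\<lambda>x. u (s + \<tau>) x - u (t + \<tau>) x)) \<longlongrightarrow> 0) (at t within {0..})"
    by (rule filterlim_compose)
qed

lemma C1_slab_shift:
  assumes u: "C1_slab u" and \<tau>: "\<tau> \<ge> 0"
  shows "C1_slab (\<lambda>t. u (t + \<tau>))"
proof -
  obtain ut ux where
    cont: "continuous_on ({0<..} \<times> {0..1}) (\<lambda>(t, x). ut t x)"
      "continuous_on ({0<..} \<times> {0..1}) (\<lambda>(t, x). ux t x)"
    and der: "\<forall>t>0. \<forall>x\<in>{0..1}. ((\<lambda>s. u s x) has_real_derivative ut t x) (at t) \<and>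
                 (u t has_real_derivative ux t x) (at x within {0..1})"
    using u unfolding C1_slab_def by blast
  have shift: "continuous_on ({0<..} \<times> {0..1}) (\<lambda>(t, x). w (t + \<tau>) x)"
    if w: "continuous_on ({0<..} \<times> {0..1}) (\<lambda>(t, x). w t x)" for w :: "real \<Rightarrow> real \<Rightarrow> real"
  proof -
    have "continuous_on ({0<..} \<times> {0..1}) (\<lambda>z. (\<lambda>(t, x). w t x) (fst z + \<tau>, snd z))"
      by (rule continuous_on_compose2[OF w]) (use \<tau> in \<open>auto intro!: continuous_intros\<close>)
    then show ?thesis
      by (simp add: case_prod_beta)
  qed
  have "((\<lambda>s. u (s + \<tau>) x) has_real_derivative ut (t + \<tau>) x) (at t) \<and>
        (u (t + \<tau>) has_real_derivative ux (t + \<tau>) x) (at x within {0..1})"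
    if "t > 0" "x \<in> {0..1}" for t x
    using der that \<tau> DERIV_shift[of "\<lambda>s. u s x" "ut (t + \<tau>) x" t \<tau>] by simp
  then show ?thesis
    unfolding C1_slab_def
    by (intro exI[of _ "\<lambda>t. ut (t + \<tau>)"] exI[of _ "\<lambda>t. ux (t + \<tau>)"]) (simp add: shift cont)
qed

lemma solution_regularity_shift:
  assumes "solution_regularity u" "\<tau> \<ge> 0"
  shows "solution_regularity (\<lambda>t. u (t + \<tau>))"
  using assms by (auto simp: solution_regularity_def C0_time_L2_shift C1_slab_shift)

lemma deriv_shift: "deriv (\<lambda>s. h (s + c)) t = deriv h (t + c)"
  for h :: "real \<Rightarrow> real"
  by (simp add: deriv_def DERIV_shift)

text \<open>
  The residual of the disturbed equation serves as the input: it satisfies the linear equation at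
  every \<open>x\<close> by construction and differs from \<open>d(t) f(u[t])\<close> only on a null set. At the time
  \<open>t + \<tau> = 0\<close> there is no equation, but the input there still counts in the supremum of the
  input-to-state estimate; it is given the value \<open>0\<close>.
\<close>

lemma disturbed_solution_restart:
  assumes sol: "disturbed_solution p q k f d u" and \<tau>: "\<tau> \<ge> 0"
    and f: "\<And>h. h \<in> L2 \<Longrightarrow> f h \<in> L2 \<and> L2norm (f h) \<le> M * L2norm h"
    and d: "\<And>t. t \<ge> 0 \<Longrightarrow> \<bar>d t\<bar> \<le> 1" and M: "M \<ge> 0"
  obtains v where "linear_solution p q k v (\<lambda>t. u (t + \<tau>))"
    "\<forall>t\<ge>0. v t \<in> L2 \<and> L2norm (v t) \<le> M * L2norm (u (t + \<tau>))"
proof -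
  define v where "v = (\<lambda>t x. if t + \<tau> = 0 then 0 else
    deriv (\<lambda>s. u s x) (t + \<tau>) - p * deriv (deriv (u (t + \<tau>))) x + q * u (t + \<tau>) x)"
  have reg: "solution_regularity u" and bc: "closed_loop_boundary k u"
    and pde: "\<And>t. t > 0 \<Longrightarrow> AE x in unit_leb.
        deriv (\<lambda>s. u s x) t = p * deriv (deriv (u t)) x - q * u t x + d t * f (u t) x"
    using sol by (auto simp: disturbed_solution_def)
  show thesis
  proof (rule that[of v])
    show "linear_solution p q k v (\<lambda>t. u (t + \<tau>))"
      unfolding linear_solution_def
    proof (intro conjI allI impI ballI)
      show "solution_regularity (\<lambda>t. u (t + \<tau>))"
        by (rule solution_regularity_shift[OF reg \<tau>])
      show "closed_loop_boundary k (\<lambda>t. u (t + \<tau>))"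
        using bc \<tau> by (auto simp: closed_loop_boundary_def)
      show "deriv (\<lambda>s. u (s + \<tau>) x) t
              = p * deriv (deriv (u (t + \<tau>))) x - q * u (t + \<tau>) x + v t x" if "t > 0" for t x
        using that \<tau> deriv_shift[of "\<lambda>s. u s x" \<tau> t] by (simp add: v_def)
    qed
  next
    have "v t \<in> L2 \<and> L2norm (v t) \<le> M * L2norm (u (t + \<tau>))" if t: "t \<ge> 0" for t
    proof (cases "t + \<tau> = 0")
      case True
      then have "v t = (\<lambda>x. 0)"
        by (simp add: v_def fun_eq_iff)
      then show ?thesis
        using M by (auto simp: L2_def L2norm_def intro!: mult_nonneg_nonneg integral_nonneg_AE)
    next
      case False
      then have pos: "t + \<tau> > 0"
        using t \<tau> by simp
      have uL: "u (t + \<tau>) \<in> L2"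
        using reg pos by (auto simp: solution_regularity_def C0_time_L2_def)
      note fu = f[OF uL]
      have eq: "AE x in unit_leb. v t x = d (t + \<tau>) * f (u (t + \<tau>)) x"
        using pde[OF pos] by eventually_elim (use False in \<open>simp add: v_def\<close>)
      have "L2norm (v t) = \<bar>d (t + \<tau>)\<bar> * L2norm (f (u (t + \<tau>)))"
        using L2_AE_cong(2)[OF L2_cmult eq] fu by (simp add: L2norm_cmult)
      also have "\<dots> \<le> 1 * L2norm (f (u (t + \<tau>)))"
        using d[of "t + \<tau>"] pos L2norm_nonneg by (intro mult_right_mono) auto
      finally show ?thesis
        using fu L2_AE_cong(1)[OF L2_cmult eq] by auto
    qed
    then show "\<forall>t\<ge>0. v t \<in> L2 \<and> L2norm (v t) \<le> M * L2norm (u (t + \<tau>))"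
      by blast
  qed
qed

section \<open>Robust stabilization\<close>

theorem proposition3p2:
  fixes p q \<gamma> M :: real
    and f :: "(real \<Rightarrow> real) \<Rightarrow> (real \<Rightarrow> real)"
    and k :: "real \<Rightarrow> real"
  assumes "p > 0"
    and "L2_continuous_map f"
    and "\<gamma> > 0"
    and "continuous_on {0..1} k"
    and "achieves_ISS p q k (\<gamma> / (p * pi\<^sup>2))"
    and "M \<ge> 0"
    and "\<forall>h\<in>L2. L2norm (f h) \<le> M * L2norm h"
    and "M < inverse \<gamma> * p * pi\<^sup>2"
  shows "achieves_robust_GES p q k f"
proof -
  define g where "g = \<gamma> / (p * pi\<^sup>2)"
  define \<kappa> where "\<kappa> = g * M"
  have g: "g > 0"
    using \<open>p > 0\<close> \<open>\<gamma> > 0\<close> by (simp add: g_def)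
  have \<kappa>: "0 \<le> \<kappa>" "\<kappa> < 1"
    using assms(1,3,6,8) by (auto simp: \<kappa>_def g_def field_simps)
  have f: "f h \<in> L2 \<and> L2norm (f h) \<le> M * L2norm h" if "h \<in> L2" for h
    using assms(2,7) that by (auto simp: L2_continuous_map_def)
  obtain G \<sigma> where "G > 0" "\<sigma> > 0" and ISS:
    "\<And>v u t. \<lbrakk>\<And>t. t \<ge> 0 \<Longrightarrow> v t \<in> L2; linear_solution p q k v u; t \<ge> 0\<rbrakk> \<Longrightarrow>
       ennreal (L2norm (u t)) \<le> ennreal (G * exp (- \<sigma> * t) * L2norm (u 0))
           + ennreal g * (SUP s\<in>{0..t}. ennreal (L2norm (v s)))"
    using assms(5) unfolding achieves_ISS_def g_def[symmetric] by blast
  obtain R \<omega> where "R > 0" "\<omega> > 0" and decay: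
    "\<And>N t. \<lbrakk>small_gain G \<sigma> \<kappa> N; t \<ge> 0\<rbrakk> \<Longrightarrow> N t \<le> R * exp (- \<omega> * t) * N 0"
    using small_gain_exponential_decay[OF \<open>G > 0\<close> \<open>\<sigma> > 0\<close> \<kappa>] by blast
  have "small_gain G \<sigma> \<kappa> (\<lambda>t. L2norm (u t))"
    if d: "\<forall>t\<ge>0. d t \<in> {-1..1}" and sol: "disturbed_solution p q k f d u" for d u
    unfolding small_gain_def
  proof (intro conjI allI impI)
    fix b :: real assume "b \<ge> 0"
    then show "\<exists>B. \<forall>s\<in>{0..b}. L2norm (u s) \<le> B"
      using sol by (intro C0_time_L2_bounded)
        (auto simp: disturbed_solution_def solution_regularity_def)
  next
    fix \<tau> t B :: real
    assume \<tau>: "\<tau> \<ge> 0" and t: "t \<ge> 0"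
      and "\<forall>s\<in>{\<tau>..\<tau> + t}. L2norm (u s) \<le> B"
    then have B: "L2norm (u s) \<le> B" if "\<tau> \<le> s" "s \<le> \<tau> + t" for s
      using that by simp
    have d': "\<bar>d s\<bar> \<le> 1" if "s \<ge> 0" for s
      using d that by (auto simp: abs_le_iff)
    obtain v where v: "linear_solution p q k v (\<lambda>t. u (t + \<tau>))"
      "\<forall>t\<ge>0. v t \<in> L2 \<and> L2norm (v t) \<le> M * L2norm (u (t + \<tau>))"
      using disturbed_solution_restart[OF sol \<tau> f d' \<open>M \<ge> 0\<close>] by blast
    have "0 \<le> B"
      using B[of \<tau>] t L2norm_nonneg[of "u \<tau>"] by simp
    have "L2norm (v s) \<le> M * B" if "s \<in> {0..t}" for s
      using v(2)[rule_format, of s] B[of "s + \<tau>"] mult_left_mono[of _ B M] that \<open>M \<ge> 0\<close> by force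
    then have sup: "(SUP s\<in>{0..t}. ennreal (L2norm (v s))) \<le> ennreal (M * B)"
      by (intro SUP_least ennreal_leI) auto
    have "ennreal (L2norm (u (t + \<tau>))) \<le> ennreal (G * exp (- \<sigma> * t) * L2norm (u (0 + \<tau>)))
           + ennreal g * (SUP s\<in>{0..t}. ennreal (L2norm (v s)))"
      using ISS[OF _ v(1) t] v(2) by blast
    also have "\<dots> \<le> ennreal (G * exp (- \<sigma> * t) * L2norm (u (0 + \<tau>))) + ennreal g * ennreal (M * B)"
      using sup by (intro add_left_mono mult_left_mono) auto
    also have "\<dots> = ennreal (G * exp (- \<sigma> * t) * L2norm (u \<tau>) + \<kappa> * B)"
      using g \<open>M \<ge> 0\<close> \<open>0 \<le> B\<close> \<open>G > 0\<close> \<kappa> L2norm_nonneg[of "u \<tau>"]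
      by (simp add: \<kappa>_def ennreal_mult[symmetric] ennreal_plus[symmetric] mult.assoc
          del: ennreal_plus)
    finally show "L2norm (u (\<tau> + t)) \<le> G * exp (- \<sigma> * t) * L2norm (u \<tau>) + \<kappa> * B"
      using \<open>0 \<le> B\<close> \<open>G > 0\<close> \<kappa> L2norm_nonneg[of "u \<tau>"]
      by (subst (asm) ennreal_le_iff) (auto simp: add.commute)
  qed (rule L2norm_nonneg)
  from decay[OF this] \<open>R > 0\<close> \<open>\<omega> > 0\<close> show ?thesis
    unfolding achieves_robust_GES_def by blast
qed

end
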